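(* Let the planar system $$\dot x=f(x,y),\qquad \dot y=\lambda_2y+g(x,y),$$ with a singularity at the origin with eigenvalues $\lambda_1=0$ and $\lambda_2$ a negative real number, have a restriction to the one-dimensional local center manifold $y=h(x)$ of class $C^r$ given by $$\dot x=f(x,h(x)),\qquad \dot y=\lambda_2y,$$ for all $x\in\mathbb{R}$ with $|x|<\delta$. Let $\phi_1(x)$ be the unit-time map of this restricted system, and assume that the two-dimensional sequence $S(x_1,y_1)=\{(x_n,y_n)\}_{n\ge1}$ on the center manifold is defined by $$x_{n+1}=\begin{cases}\phi_1(x_n), & \text{if } x_0 \text{ is stable},\\ \phi_1^{-1}(x_n), & \text{if } x_0\text{ is unstable},\end{cases}\qquad y_{n+1}=h(x_{n+1}),$$ with the initial point $(x_1,y_1)$, $y_1=h(x_1)$. If the map $\phi_1$ is $k$-nondegenerate in the point $x_0=0$, then there exists $\rho>0$ such that for $\|(x_1,y_1)\|<\rho$ we have $$\dim_BS(x_1,y_1)=1-\frac1k.$$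
   Context: The functions $f,g$ are sufficiently smooth near the origin, with Taylor expansions there starting with at least quadratic terms. The unit-time map is the time-$1$ map of the flow (near $0$); $\phi_1(x)$ is a map of the single variable $x$, coming from the equation $\dot x=f(x,h(x))$, and $x_0=0$ is its fixed point and the singularity of that equation. A sufficiently smooth map $\phi$ of the real line with $\phi(0)=0$, $\phi'(0)=1$ is $k$-nondegenerate in $0$ ($k\ge2$ an integer) if $\phi''(0)=\dots=\phi^{(k-1)}(0)=0$ and $\phi^{(k)}(0)\neq0$. A sequence is identified with its set of points. Box dimension: for a bounded set $A\subset\mathbb{R}^N$ let $A_\varepsilon=\{y\in\mathbb{R}^N: d(y,A)<\varepsilon\}$ and let $|A_\varepsilon|$ be its Lebesgue measure. For $s\ge 0$ put $\mathcal{M}_*^s(A)=\liminf_{\varepsilon\to0}|A_\varepsilon|/\varepsilon^{N-s}$ and $\mathcal{M}^{*s}(A)=\limsup_{\varepsilon\to0}|A_\varepsilon|/\varepsilon^{N-s}$. The lower and upper box dimensions are $\underline{\dim}_B A=\inf\{s>0:\mathcal{M}_*^s(A)=0\}$ and $\overline{\dim}_B A=\inf\{s>0:\mathcal{M}^{*s}(A)=0\}$; if they coincide, the common value is denoted $\dim_B A$.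
   Formalization: The initial point is required to have x_1 ≠ 0 (at the fixed point the sequence is one point of dimension 0), and stability of x_0 is taken on the side of x_1, since for even k the fixed point is semistable and φ_1^{-1} would leave the neighbourhood on the attracting side. *)

theory Defs
  imports "HOL-Analysis.Analysis"
begin

primrec Ck_on :: "nat \<Rightarrow> ('a::euclidean_space \<Rightarrow> 'b::real_normed_vector) \<Rightarrow> 'a set \<Rightarrow> bool" where
  "Ck_on 0 f U \<longleftrightarrow> continuous_on U f"
| "Ck_on (Suc n) f U \<longleftrightarrow>
     (\<forall>x\<in>U. f differentiable (at x)) \<and>
     (\<forall>v. Ck_on n (\<lambda>x. frechet_derivative f (at x) v) U)"

text \<open>The Taylor expansion at \<open>p\<close> has no constant and no linear term.\<close>

definition starts_quadratic_at ::
    "('a::real_normed_vector \<Rightarrow> 'b::real_normed_vector) \<Rightarrow> 'a \<Rightarrow> bool" where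
  "starts_quadratic_at f p \<longleftrightarrow> f p = 0 \<and> (f has_derivative (\<lambda>_. 0)) (at p)"

definition planar_field ::
    "(real \<times> real \<Rightarrow> real) \<Rightarrow> (real \<times> real \<Rightarrow> real) \<Rightarrow> real \<Rightarrow> real \<times> real \<Rightarrow> real \<times> real" where
  "planar_field f g lam\<^sub>2 p = (f p, lam\<^sub>2 * snd p + g p)"

text \<open>By uniqueness of solutions, the trajectory \<open>u\<close> below is the one starting at \<open>p\<close>.\<close>

definition locally_invariant ::
    "('a::real_normed_vector \<Rightarrow> 'a) \<Rightarrow> 'a set \<Rightarrow> bool" where
  "locally_invariant V M \<longleftrightarrow>
     (\<forall>p\<in>M. \<exists>T>0. \<exists>u::real \<Rightarrow> 'a. u 0 = p \<and>
        (\<forall>t\<in>{-T<..<T}. u t \<in> M \<and> (u has_vector_derivative V (u t)) (at t)))"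

text \<open>The graph of \<open>h\<close> over \<open>|x| < \<delta>\<close> is a local center manifold of class \<open>C\<^sup>r\<close> at the origin of
  the field \<open>V\<close>, whose center direction is the \<open>x\<close>-axis; \<open>U\<close> is the domain of \<open>V\<close>.\<close>

definition local_center_manifold ::
    "nat \<Rightarrow> (real \<times> real) set \<Rightarrow> (real \<times> real \<Rightarrow> real \<times> real) \<Rightarrow> real \<Rightarrow> (real \<Rightarrow> real) \<Rightarrow> bool" where
  "local_center_manifold r U V \<delta> h \<longleftrightarrow>
     0 < \<delta> \<and> Ck_on r h {-\<delta><..<\<delta>} \<and>
     h 0 = 0 \<and> (h has_real_derivative 0) (at 0) \<and>
     (\<lambda>x. (x, h x)) ` {-\<delta><..<\<delta>} \<subseteq> U \<and>
     locally_invariant V ((\<lambda>x. (x, h x)) ` {-\<delta><..<\<delta>})"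

text \<open>The values of \<open>\<phi>\<close> are those of the time-1 map of \<open>x' = F x\<close>, \<open>|x| < \<delta>\<close>, on the neighbourhood
  \<open>D\<close> of 0; nothing is said about \<open>\<phi>\<close> outside \<open>D\<close>.\<close>

definition unit_time_map_on ::
    "(real \<Rightarrow> real) \<Rightarrow> real \<Rightarrow> real set \<Rightarrow> (real \<Rightarrow> real) \<Rightarrow> bool" where
  "unit_time_map_on F \<delta> D \<phi> \<longleftrightarrow>
     open D \<and> 0 \<in> D \<and>
     (\<forall>x\<in>D. \<exists>u. u 0 = x \<and> u 1 = \<phi> x \<and>
        (\<forall>t\<in>{0..1}. \<bar>u t\<bar> < \<delta> \<and> (u has_real_derivative F (u t)) (at t within {0..1})))"

text \<open>On an open set where \<open>\<phi>\<close> is \<open>C\<^sup>k\<close>, \<open>(deriv ^^ j) \<phi>\<close> is the \<open>j\<close>-th derivative for \<open>j \<le> k\<close>.\<close>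

definition nondegenerate_at_0 :: "nat \<Rightarrow> (real \<Rightarrow> real) \<Rightarrow> bool" where
  "nondegenerate_at_0 k \<phi> \<longleftrightarrow>
     2 \<le> k \<and> (\<exists>W. open W \<and> 0 \<in> W \<and> Ck_on k \<phi> W) \<and>
     \<phi> 0 = 0 \<and> deriv \<phi> 0 = 1 \<and>
     (\<forall>j. 2 \<le> j \<and> j < k \<longrightarrow> (deriv ^^ j) \<phi> 0 = 0) \<and> (deriv ^^ k) \<phi> 0 \<noteq> 0"

text \<open>Lyapunov stability of the fixed point 0 with respect to initial points on the side of \<open>a\<close>,
  \<open>a \<noteq> 0\<close>. For a \<open>k\<close>-nondegenerate map with \<open>k\<close> odd, this is the usual stability for either sign
  of \<open>a\<close>; with \<open>k\<close> even, 0 is stable from exactly one side.\<close>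

definition stable_from_side_of :: "real \<Rightarrow> (real \<Rightarrow> real) \<Rightarrow> bool" where
  "stable_from_side_of a \<phi> \<longleftrightarrow>
     (\<forall>e>0. \<exists>d>0. \<forall>x. sgn x = sgn a \<and> \<bar>x\<bar> < d \<longrightarrow> (\<forall>n. \<bar>(\<phi> ^^ n) x\<bar> < e))"

text \<open>Meant for nonempty sets: \<open>infdist y {} = 0\<close>.\<close>

definition parallel_set :: "'a::metric_space set \<Rightarrow> real \<Rightarrow> 'a set" where
  "parallel_set A e = {y. infdist y A < e}"

definition lower_content :: "real \<Rightarrow> 'a::euclidean_space set \<Rightarrow> ereal" where
  "lower_content s A =
     Liminf (at_right 0) (\<lambda>e. ereal (measure lebesgue (parallel_set A e) / e powr (real DIM('a) - s)))"

definition upper_content :: "real \<Rightarrow> 'a::euclidean_space set \<Rightarrow> ereal" where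
  "upper_content s A =
     Limsup (at_right 0) (\<lambda>e. ereal (measure lebesgue (parallel_set A e) / e powr (real DIM('a) - s)))"

definition lower_box_dim :: "'a::euclidean_space set \<Rightarrow> real" where
  "lower_box_dim A = Inf {s. 0 < s \<and> lower_content s A = 0}"

definition upper_box_dim :: "'a::euclidean_space set \<Rightarrow> real" where
  "upper_box_dim A = Inf {s. 0 < s \<and> upper_content s A = 0}"

definition has_box_dim :: "'a::euclidean_space set \<Rightarrow> real \<Rightarrow> bool" where
  "has_box_dim A d \<longleftrightarrow> bounded A \<and> lower_box_dim A = d \<and> upper_box_dim A = d"

end

theory Submission
  imports Defs
begin

text \<open>
  A \<open>k\<close>-nondegenerate map satisfies \<open>\<phi> x = x + c(x) x\<^sup>k\<close> with \<open>c\<close> of constant sign and bounded away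
  from \<open>0\<close>, so the orbit converging to \<open>0\<close> has gaps \<open>X n - X (n + 1)\<close> comparable to \<open>X n\<^sup>k\<close>.
  With \<open>t = \<epsilon>\<close> to the power \<open>1 / k\<close>, the about \<open>t / \<epsilon>\<close> points with \<open>X n \<ge> t\<close> are \<open>\<epsilon>\<close>-separated up
  to constants, and the points with \<open>X n \<le> t\<close> lie on an arc of length about \<open>t\<close>, which about \<open>t / \<epsilon>\<close>
  balls of radius \<open>\<epsilon>\<close> cover. Hence the \<open>\<epsilon>\<close>-neighbourhood in dimension \<open>N\<close> has measure comparable
  to \<open>t\<close> times the \<open>(N - 1)\<close>-st power of \<open>\<epsilon>\<close>. Lifting the orbit to the center manifold is bi-Lipschitz and changes
  nothing. In the unstable case the global inverse on \<open>D\<close> agrees with the local one because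
  uniqueness of solutions makes the time-1 map injective on \<open>D\<close>.
\<close>

subsection \<open>Box dimension from covering and packing\<close>

lemma open_parallel_set: "open (parallel_set A e)"
  unfolding parallel_set_def by (intro open_Collect_less continuous_intros)

lemma parallel_set_eq_UN_ball: "A \<noteq> {} \<Longrightarrow> parallel_set A e = (\<Union>a\<in>A. ball a e)"
  unfolding parallel_set_def
  by (auto simp: infdist_notempty cINF_less_iff dist_commute)

lemma measure_lebesgue_ball:
  fixes c :: "'a::euclidean_space"
  assumes "r \<ge> 0"
  shows "measure lebesgue (ball c r) = unit_ball_vol (real DIM('a)) * r ^ DIM('a)"
  using content_ball[OF assms, of c] by (simp add: measure_completion)

lemma bounded_parallel_set:
  fixes A :: "'a::euclidean_space set"
  assumes "bounded A" "A \<noteq> {}"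
  shows "bounded (parallel_set A e)"
proof -
  from \<open>bounded A\<close> obtain c r where "A \<subseteq> cball c r"
    by (metis bounded_subset_cball)
  then have "parallel_set A e \<subseteq> cball c (r + e)"
    unfolding parallel_set_eq_UN_ball[OF \<open>A \<noteq> {}\<close>]
  proof (intro UN_least subsetI)
    fix a y assume "a \<in> A" "y \<in> ball a e"
    with \<open>A \<subseteq> cball c r\<close> have "dist c a \<le> r" "dist a y < e" by auto
    then show "y \<in> cball c (r + e)" using dist_triangle[of c y a] by simp
  qed
  then show ?thesis
    using bounded_subset bounded_cball by blast
qed

text \<open>Each point of the parallel set is within \<open>e\<close> of some point of
  \<open>A\<close>, hence within \<open>r + e\<close> of a center in \<open>P\<close>; the bound
  sums the volumes of these enlarged balls.\<close>

lemma measure_parallel_set_le_covering: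
  fixes A P :: "'a::euclidean_space set"
  assumes "A \<noteq> {}" "finite P" "A \<subseteq> (\<Union>c\<in>P. cball c r)" "r \<ge> 0" "e \<ge> 0"
  shows "measure lebesgue (parallel_set A e)
           \<le> real (card P) * (unit_ball_vol (real DIM('a)) * (r + e) ^ DIM('a))"
proof -
  have "parallel_set A e \<subseteq> (\<Union>c\<in>P. ball c (r + e))"
  proof
    fix y assume "y \<in> parallel_set A e"
    then obtain a where "a \<in> A" "dist a y < e"
      by (auto simp: parallel_set_eq_UN_ball[OF assms(1)])
    moreover obtain c where "c \<in> P" "dist c a \<le> r"
      using \<open>a \<in> A\<close> assms(3) by auto
    ultimately show "y \<in> (\<Union>c\<in>P. ball c (r + e))"
      using dist_triangle[of c y a] by force
  qed
  then have "measure lebesgue (parallel_set A e) \<le> measure lebesgue (\<Union>c\<in>P. ball c (r + e))"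
    by (rule measure_mono_fmeasurable)
       (auto intro!: fmeasurable.finite_UN assms simp: open_parallel_set borel_open lmeasurable_ball)
  also have "\<dots> \<le> (\<Sum>c\<in>P. measure lebesgue (ball c (r + e)))"
    by (rule measure_UNION_le) (use assms in auto)
  also have "\<dots> = real (card P) * (unit_ball_vol (real DIM('a)) * (r + e) ^ DIM('a))"
    using assms by (simp add: measure_lebesgue_ball del: measure_completion)
  finally show ?thesis .
qed

text \<open>Open balls of radius \<open>e\<close> about \<open>2 * e\<close>-separated points are
  disjoint and lie in the parallel set. Boundedness of \<open>A\<close> gives that set finite
  measure, as monotonicity of \<open>measure\<close> requires.\<close>

lemma measure_parallel_set_ge_packing:
  fixes A P :: "'a::euclidean_space set"
  assumes "bounded A" "finite P" "P \<noteq> {}" "P \<subseteq> A" "e \<ge> 0"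
    and sep: "\<And>p q. p \<in> P \<Longrightarrow> q \<in> P \<Longrightarrow> p \<noteq> q \<Longrightarrow> dist p q \<ge> 2 * e"
  shows "real (card P) * (unit_ball_vol (real DIM('a)) * e ^ DIM('a))
           \<le> measure lebesgue (parallel_set A e)"
proof -
  have "A \<noteq> {}" using assms by auto
  have disj: "disjoint_family_on (\<lambda>p. ball p e) P"
    unfolding disjoint_family_on_def
  proof (intro ballI impI)
    fix p q assume "p \<in> P" "q \<in> P" "p \<noteq> q"
    show "ball p e \<inter> ball q e = {}"
      using sep[OF \<open>p \<in> P\<close> \<open>q \<in> P\<close> \<open>p \<noteq> q\<close>] dist_triangle_less_add[of p _ e q e]
      by (force simp: dist_commute)
  qed
  have "real (card P) * (unit_ball_vol (real DIM('a)) * e ^ DIM('a))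
          = (\<Sum>p\<in>P. measure lebesgue (ball p e))"
    using assms by (simp add: measure_lebesgue_ball del: measure_completion)
  also have "\<dots> = measure lebesgue (\<Union>p\<in>P. ball p e)"
    using assms(2) disj by (subst measure_finite_Union) (auto simp: less_imp_neq[OF emeasure_lborel_ball_finite, unfolded infinity_ennreal_def])
  also have "\<dots> \<le> measure lebesgue (parallel_set A e)"
  proof (rule measure_mono_fmeasurable)
    show "(\<Union>p\<in>P. ball p e) \<subseteq> parallel_set A e"
      using assms(4) by (auto simp: parallel_set_eq_UN_ball[OF \<open>A \<noteq> {}\<close>])
    show "parallel_set A e \<in> lmeasurable"
      using bounded_parallel_set[OF assms(1) \<open>A \<noteq> {}\<close>] open_parallel_set lmeasurable_open by blast
  qed (use assms in auto)
  finally show ?thesis .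
qed

text \<open>The candidates form the ray \<open>{d<..}\<close>. An arbitrary \<open>C\<close> lets
  the lemma serve both the lower and the upper content.\<close>

lemma Inf_box_dim_candidates:
  fixes C :: "real \<Rightarrow> ereal"
  assumes "d > 0" and small: "\<And>s. s > d \<Longrightarrow> C s = 0" and big: "\<And>s. s \<le> d \<Longrightarrow> C s > 0"
  shows "Inf {s. 0 < s \<and> C s = 0} = d"
proof -
  have "{s. 0 < s \<and> C s = 0} = {d<..}"
    using assms by (force simp: not_le[symmetric])
  then show ?thesis by simp
qed

lemma tendsto_powr_at_right_0:
  fixes s :: real
  assumes "s > 0"
  shows "((\<lambda>e. e powr s) \<longlongrightarrow> 0) (at_right 0)"
proof (rule tendsto_zero_powrI[where b = s])
  show "eventually (\<lambda>e. 0 \<le> e) (at_right (0::real))"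
    using eventually_at_right_less[of "0::real"] by (rule eventually_mono) simp
qed (use assms in \<open>auto intro: tendsto_ident_at\<close>)

text \<open>Division by \<open>e powr (N - s)\<close>, with \<open>N\<close> the dimension, leaves a
  quotient between \<open>c * e powr (s - d)\<close> and \<open>C * e powr (s - d)\<close>. It tends
  to 0 for \<open>s > d\<close> and, once \<open>e < 1\<close>, is at least \<open>c\<close> for
  \<open>s \<le> d\<close>.\<close>

lemma has_box_dim_if_power_bounds:
  fixes A :: "'a::euclidean_space set"
  assumes "bounded A" "d > 0" "c > 0"
    and bounds: "eventually (\<lambda>e. c * e powr (real DIM('a) - d) \<le> measure lebesgue (parallel_set A e) \<and>
                  measure lebesgue (parallel_set A e) \<le> C * e powr (real DIM('a) - d)) (at_right 0)"
  shows "has_box_dim A d"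
proof -
  define \<mu> where "\<mu> s e = measure lebesgue (parallel_set A e) / e powr (real DIM('a) - s)" for s e
  have lower: "lower_content s A = Liminf (at_right 0) (\<lambda>e. ereal (\<mu> s e))"
    and upper: "upper_content s A = Limsup (at_right 0) (\<lambda>e. ereal (\<mu> s e))" for s
    by (simp_all add: lower_content_def upper_content_def \<mu>_def)
  have bd: "eventually (\<lambda>e. c * e powr (s - d) \<le> \<mu> s e \<and> \<mu> s e \<le> C * e powr (s - d)) (at_right 0)" for s
    using bounds eventually_at_right_less[of 0]
  proof eventually_elim
    case (elim e)
    have "e powr (real DIM('a) - d) = e powr (s - d) * e powr (real DIM('a) - s)"
      by (simp flip: powr_add)
    with elim show ?case by (simp add: \<mu>_def field_simps)
  qed
  have le: "lower_content s A \<le> upper_content s A" for s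
    unfolding lower upper by (rule Liminf_le_Limsup) simp
  have zero: "(\<mu> s \<longlongrightarrow> 0) (at_right 0)" if "s > d" for s
  proof (rule tendsto_sandwich)
    have *: "((\<lambda>e. e powr (s - d)) \<longlongrightarrow> 0) (at_right 0)"
      using that by (intro tendsto_powr_at_right_0) simp
    show "((\<lambda>e. c * e powr (s - d)) \<longlongrightarrow> 0) (at_right 0)" "((\<lambda>e. C * e powr (s - d)) \<longlongrightarrow> 0) (at_right 0)"
      using tendsto_mult_right_zero[OF *] by auto
  qed (use bd[of s] in \<open>auto elim: eventually_mono\<close>)
  have small: "lower_content s A = 0" "upper_content s A = 0" if "s > d" for s
    unfolding lower upper using zero[OF that]
    by (auto intro!: lim_imp_Liminf lim_imp_Limsup simp: zero_ereal_def)
  have big: "lower_content s A > 0" if "s \<le> d" for s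
  proof -
    have "eventually (\<lambda>e. ereal c \<le> ereal (\<mu> s e)) (at_right 0)"
      using bd[of s] eventually_at_right_less[of 0] eventually_at_right_real[of 0 1, simplified]
    proof eventually_elim
      case (elim e)
      have "e powr 0 \<le> e powr (s - d)"
        using elim that by (intro powr_mono') auto
      then have "1 \<le> e powr (s - d)" using elim by auto
      then have "c * 1 \<le> c * e powr (s - d)"
        using \<open>c > 0\<close> by (intro mult_left_mono) auto
      with elim show ?case by simp
    qed
    then have "ereal c \<le> lower_content s A"
      unfolding lower by (rule Liminf_bounded)
    with \<open>c > 0\<close> show ?thesis
      by (metis ereal_less(2) order_less_le_trans)
  qed
  have big': "upper_content s A > 0" if "s \<le> d" for s
    using big[OF that] le[of s] by (rule less_le_trans)
  show ?thesis
    unfolding has_box_dim_def lower_box_dim_def upper_box_dim_def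
    using assms(1,2) small big big' by (auto intro!: Inf_box_dim_candidates)
qed

subsection \<open>Orbits with power-law gaps on a curve\<close>

text \<open>\<open>up\<close> and \<open>lo\<close> put each gap between \<open>a * X n ^ k\<close>
  and \<open>b * X n ^ k\<close>, and \<open>small\<close> keeps it a bounded fraction of
  \<open>X n\<close>. The curve is controlled on all of \<open>{0..X 0}\<close> because the covering
  also uses points of the arc outside the orbit.\<close>

lemma has_box_dim_orbit_on_curve:
  fixes \<gamma> :: "real \<Rightarrow> 'a::euclidean_space" and X :: "nat \<Rightarrow> real"
  assumes "2 \<le> k" and pos: "\<And>n. 0 < X n" and "0 < a"
    and up: "\<And>n. X (Suc n) \<le> X n - a * X n ^ k"
    and lo: "\<And>n. X n - b * X n ^ k \<le> X (Suc n)"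
    and small: "2 * real (k - 1) * (b * X 0 ^ (k - 1)) \<le> 1"
    and expand: "\<And>s t. s \<in> {0..X 0} \<Longrightarrow> t \<in> {0..X 0} \<Longrightarrow> \<bar>s - t\<bar> \<le> dist (\<gamma> s) (\<gamma> t)"
    and lip: "\<And>s t. s \<in> {0..X 0} \<Longrightarrow> t \<in> {0..X 0} \<Longrightarrow> dist (\<gamma> s) (\<gamma> t) \<le> L * \<bar>s - t\<bar>"
  shows "has_box_dim (range (\<lambda>n. \<gamma> (X n))) (1 - 1 / real k)"
proof -
  obtain K where k: "k = Suc K" and K: "K \<ge> 1"
    using \<open>2 \<le> k\<close> by (cases k) auto
  define A where "A = range (\<lambda>n. \<gamma> (X n))"
  define V where "V = unit_ball_vol (real DIM('a))"
  have V: "V > 0" by (simp add: V_def)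
  have Suc_less: "X (Suc n) < X n" for n
    using up[of n] pos[of n] \<open>0 < a\<close> by (smt (verit) mult_pos_pos zero_less_power)
  then have anti: "X n \<le> X m" if "m \<le> n" for m n
    using that by (metis lift_Suc_antimono_le less_imp_le)
  have range: "X n \<in> {0..X 0}" for n
    using anti[of 0 n] pos[of n] by auto
  have "a \<le> b"
    using order_trans[OF lo[of 0] up[of 0]] pos[of 0] by simp
  then have "b > 0" using \<open>0 < a\<close> by simp
  have "L \<ge> 1"
    using order_trans[OF expand[of 0 "X 0"] lip[of 0 "X 0"]] pos[of 0] by simp

  \<comment> \<open>In the coordinate \<open>z\<close> the recursion becomes a translation up to bounded factors.\<close>
  define z where "z n = 1 / X n ^ K" for n
  have z_ge_Suc: "z n + a \<le> z (Suc n)" for n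
  proof -
    define u where "u = a * X n ^ K"
    have u: "u > 0" using pos[of n] \<open>0 < a\<close> by (simp add: u_def)
    have le: "X (Suc n) \<le> X n * (1 - u)"
      using up[of n] by (simp add: u_def k algebra_simps)
    have "u < 1"
      using pos[of n] pos[of "Suc n"] le by (smt (verit) mult_nonneg_nonpos)
    have "X (Suc n) ^ K \<le> X n ^ K * (1 - u) ^ K"
      using power_mono[OF le, of K] pos[of "Suc n"] by (simp add: power_mult_distrib)
    also have "\<dots> \<le> X n ^ K * (1 - u)"
      using power_decreasing[of 1 K "1 - u"] K u \<open>u < 1\<close> pos[of n] by simp
    \<comment> \<open>Since \<open>(1 - u) * (1 + u) \<le> 1\<close>, \<open>z\<close> grows at
      least by the factor \<open>1 + u\<close>, and \<open>z n * u = a\<close>.\<close>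
    finally have "X (Suc n) ^ K * (1 + u) \<le> X n ^ K * (1 - u) * (1 + u)"
      using u by (intro mult_right_mono) auto
    also have "\<dots> \<le> X n ^ K"
      using pos[of n] u by (simp add: algebra_simps zero_le_mult_iff)
    finally have "(1 + u) / X n ^ K \<le> z (Suc n)"
      using pos[of n] pos[of "Suc n"] by (simp add: z_def field_simps)
    then show ?thesis
      using pos[of n] by (simp add: z_def u_def add_divide_distrib)
  qed
  \<comment> \<open>To first order \<open>z\<close> increases by at most \<open>K * b\<close> in one
    step; the factor 2 absorbs the higher-order terms.\<close>
  define B where "B = 2 * real K * b"
  have B: "B > 0" using K \<open>b > 0\<close> by (simp add: B_def)
  have z_Suc_le: "z (Suc n) \<le> z n + B" for n
  proof -
    define v where "v = b * X n ^ K"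
    have v: "v > 0" using pos[of n] \<open>0 < b\<close> by (simp add: v_def)
    have "v \<le> b * X 0 ^ K"
      using anti[of 0 n] pos[of n] \<open>b > 0\<close> by (auto simp: v_def intro!: power_mono)
    then have "2 * real K * v \<le> 2 * real K * (b * X 0 ^ K)"
      by (intro mult_left_mono) auto
    then have Kv: "2 * (real K * v) \<le> 1" using small by (simp add: k)
    moreover have "v \<le> real K * v" using K v by simp
    ultimately have "v \<le> 1" using v by linarith
    have le: "X n * (1 - v) \<le> X (Suc n)"
      using lo[of n] by (simp add: v_def k algebra_simps)
    have "1 - real K * v \<le> (1 - v) ^ K"
      using Bernoulli_inequality[of "- v" K] \<open>v \<le> 1\<close> by simp
    then have "X n ^ K * (1 - real K * v) \<le> X n ^ K * (1 - v) ^ K"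
      using pos[of n] by (intro mult_left_mono) auto
    also have "\<dots> \<le> X (Suc n) ^ K"
      using power_mono[OF le, of K] pos[of n] \<open>v \<le> 1\<close> by (simp add: power_mult_distrib)
    finally have "X n ^ K * (1 - real K * v) * (1 + 2 * (real K * v)) \<le> X (Suc n) ^ K * (1 + 2 * (real K * v))"
      using v by (intro mult_right_mono) auto
    \<comment> \<open>With \<open>p = real K * v \<le> 1 / 2\<close> the product is
      \<open>1 + p * (1 - 2 * p)\<close>, so \<open>1 + 2 * p\<close> bounds
      \<open>1 / (1 - p)\<close> from above.\<close>
    moreover have "1 \<le> (1 - real K * v) * (1 + 2 * (real K * v))"
    proof -
      have "0 \<le> (real K * v) * (1 - 2 * (real K * v))"
        using Kv v by (intro mult_nonneg_nonneg) auto
      then show ?thesis by (simp add: algebra_simps)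
    qed
    then have "X n ^ K * 1 \<le> X n ^ K * ((1 - real K * v) * (1 + 2 * (real K * v)))"
      using pos[of n] by (intro mult_left_mono) auto
    ultimately have "X n ^ K \<le> X (Suc n) ^ K * (1 + 2 * (real K * v))"
      by (simp add: mult.assoc)
    then have "z (Suc n) \<le> (1 + 2 * (real K * v)) / X n ^ K"
      using pos[of n] pos[of "Suc n"] by (simp add: z_def field_simps)
    then show ?thesis
      using pos[of n] by (simp add: z_def v_def B_def add_divide_distrib)
  qed
  \<comment> \<open>\<open>z_ge\<close> will bound the number of orbit points above a level from
    above, \<open>z_le\<close> from below.\<close>
  have z_ge: "real n * a \<le> z n" for n
  proof (induction n)
    case 0 show ?case using pos[of 0] by (simp add: z_def)
  next
    case (Suc n) then show ?case using z_ge_Suc[of n] by (simp add: algebra_simps)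
  qed
  have z_le: "z n \<le> z 0 + real n * B" for n
  proof (induction n)
    case (Suc n) then show ?case using z_Suc_le[of n] by (simp add: algebra_simps)
  qed simp

  have "bounded A"
  proof (rule bounded_subset)
    show "A \<subseteq> cball (\<gamma> (X 0)) (L * X 0)"
    proof (clarsimp simp: A_def)
      fix n
      have "dist (\<gamma> (X 0)) (\<gamma> (X n)) \<le> L * \<bar>X 0 - X n\<bar>"
        by (rule lip) (use range in auto)
      also have "\<dots> \<le> L * X 0"
        using range[of n] \<open>L \<ge> 1\<close> by (intro mult_left_mono) auto
      finally show "dist (\<gamma> (X 0)) (\<gamma> (X n)) \<le> L * X 0" .
    qed
  qed simp
  \<comment> \<open>In units of \<open>1 / t ^ K\<close>, the covering has at most
    \<open>1 / a\<close> orbit points, 1 for the grid points and 2 for the points of index 0; the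
    balls have radius \<open>(L + 1) * e\<close>.\<close>
  define C where "C = (1 / a + 3) * (V * (L + 1) ^ DIM('a))"
  \<comment> \<open>This gives \<open>a * w ^ k \<ge> 2\<close>, so the gap after an orbit point
    with \<open>X n \<ge> w * t\<close> is at least \<open>2 * t ^ k\<close>.\<close>
  define w where "w = max 1 (2 / a)"
  define c where "c = V / (2 * B * w ^ K)"
  have "w \<ge> 1" by (simp add: w_def)
  then have "c > 0" using V B by (simp add: c_def)

  have upper: "measure lebesgue (parallel_set A (t ^ k)) \<le> C * ((t ^ k) ^ DIM('a) / t ^ K)"
    if t: "0 < t" "t \<le> 1" for t
  proof -
    define e where "e = t ^ k"
    have e: "e > 0" using t by (simp add: e_def)
    have te: "t / e = 1 / t ^ K" using t by (simp add: e_def k)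
    define n0 where "n0 = nat \<lfloor>1 / (a * t ^ K)\<rfloor>"
    define j0 where "j0 = nat \<lfloor>1 / t ^ K\<rfloor>"
    \<comment> \<open>Grid points beyond \<open>X 0\<close> are dropped because \<open>lip\<close>
      is available only on \<open>{0..X 0}\<close>.\<close>
    define J where "J = {j. j \<le> j0 \<and> real j * e \<le> X 0}"
    have "J \<subseteq> {..j0}" by (auto simp: J_def)
    then have J: "finite J" "card J \<le> Suc j0"
      using finite_subset card_mono[of "{..j0}" J] by auto
    define P where "P = (\<lambda>n. \<gamma> (X n)) ` {..n0} \<union> (\<lambda>j. \<gamma> (real j * e)) ` J"
    have "card P \<le> card ((\<lambda>n. \<gamma> (X n)) ` {..n0}) + card ((\<lambda>j. \<gamma> (real j * e)) ` J)"
      unfolding P_def by (rule card_Un_le)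
    also have "\<dots> \<le> Suc n0 + Suc j0"
      using card_image_le[of "{..n0}" "\<lambda>n. \<gamma> (X n)"] card_image_le[OF J(1), of "\<lambda>j. \<gamma> (real j * e)"] J(2)
      by simp
    finally have "real (card P) \<le> real n0 + real j0 + 2" by linarith
    also have "\<dots> \<le> 1 / (a * t ^ K) + 1 / t ^ K + 2 / t ^ K"
    proof -
      have "real n0 \<le> 1 / (a * t ^ K)" "real j0 \<le> 1 / t ^ K"
        using t \<open>0 < a\<close> by (auto simp: n0_def j0_def intro!: of_nat_floor)
      moreover have "2 \<le> 2 / t ^ K"
        using t by (simp add: field_simps power_le_one)
      ultimately show ?thesis by linarith
    qed
    also have "\<dots> = (1 / a + 3) / t ^ K" using t \<open>0 < a\<close> by (simp add: field_simps)
    finally have cardP: "real (card P) \<le> (1 / a + 3) / t ^ K" .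
    have "A \<subseteq> (\<Union>c\<in>P. cball c (L * e))"
    proof
      fix p assume "p \<in> A"
      then obtain n where p: "p = \<gamma> (X n)" by (auto simp: A_def)
      show "p \<in> (\<Union>c\<in>P. cball c (L * e))"
      \<comment> \<open>Above the level \<open>t\<close> the point is itself a center; otherwise
        rounding \<open>X n\<close> down to a multiple of \<open>e\<close> gives a center within
        \<open>L * e\<close>.\<close>
      proof (cases "X n > t")
        case True
        then have "t ^ K \<le> X n ^ K" using t by (intro power_mono) auto
        then have "z n \<le> 1 / t ^ K" using t pos[of n] by (simp add: z_def frac_le)
        then have "real n * a \<le> 1 / t ^ K" using z_ge[of n] by linarith
        then have "real n \<le> 1 / (a * t ^ K)" using \<open>0 < a\<close> t by (simp add: field_simps)
        then have "n \<le> n0" unfolding n0_def by (simp add: le_nat_floor)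
        then have "\<gamma> (X n) \<in> P" by (auto simp: P_def)
        then show ?thesis using p e \<open>L \<ge> 1\<close> by (auto intro!: bexI[of _ "\<gamma> (X n)"])
      next
        case False
        define j where "j = nat \<lfloor>X n / e\<rfloor>"
        have jle: "real j \<le> X n / e" using pos[of n] e by (auto simp: j_def intro!: of_nat_floor)
        have "X n / e < real j + 1" unfolding j_def by linarith
        with jle e have j: "real j * e \<le> X n" "X n - real j * e \<le> e"
          by (simp_all add: field_simps)
        have "real j \<le> 1 / t ^ K"
          using jle False e te by (smt (verit) divide_right_mono)
        then have "j \<le> j0" unfolding j0_def by (simp add: le_nat_floor)
        with j(1) range[of n] have "j \<in> J" by (auto simp: J_def)
        have "dist (\<gamma> (real j * e)) (\<gamma> (X n)) \<le> L * \<bar>real j * e - X n\<bar>"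
          by (rule lip) (use range[of n] j e in auto)
        also have "\<dots> \<le> L * e" using j \<open>L \<ge> 1\<close> by (intro mult_left_mono) auto
        finally show ?thesis using \<open>j \<in> J\<close> p by (auto simp: P_def)
      qed
    qed
    moreover have "finite P" using J by (simp add: P_def)
    ultimately have "measure lebesgue (parallel_set A e)
        \<le> real (card P) * (unit_ball_vol (real DIM('a)) * (L * e + e) ^ DIM('a))"
      using e \<open>L \<ge> 1\<close> by (intro measure_parallel_set_le_covering) (auto simp: A_def)
    also have "\<dots> = real (card P) * (V * (L + 1) ^ DIM('a) * e ^ DIM('a))"
      by (simp add: V_def power_mult_distrib[symmetric] algebra_simps)
    also have "\<dots> \<le> (1 / a + 3) / t ^ K * (V * (L + 1) ^ DIM('a) * e ^ DIM('a))"
      using cardP V e \<open>L \<ge> 1\<close> by (intro mult_right_mono) auto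
    finally show ?thesis by (simp add: C_def e_def)
  qed

  have lower: "c * ((t ^ k) ^ DIM('a) / t ^ K) \<le> measure lebesgue (parallel_set A (t ^ k))"
    if t: "0 < t" "w * t \<le> X 0 / 2" for t
  proof -
    define e where "e = t ^ k"
    have e: "e > 0" using t by (simp add: e_def)
    have wt: "w * t > 0" using t \<open>w \<ge> 1\<close> by simp
    have "(w * t) ^ K \<le> (X 0 / 2) ^ K" using t wt by (intro power_mono) auto
    also have "\<dots> \<le> X 0 ^ K / 2"
    proof -
      have "(2::real) ^ 1 \<le> 2 ^ K" using K by (intro power_increasing) auto
      then have "X 0 ^ K / 2 ^ K \<le> X 0 ^ K / 2" using pos[of 0] by (intro divide_left_mono) auto
      then show ?thesis by (simp add: power_divide)
    qed
    \<comment> \<open>The start value \<open>z 0\<close> uses up at most half of the threshold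
      \<open>1 / (w * t) ^ K\<close>; the other half is available for counting steps.\<close>
    finally have z0: "2 * z 0 \<le> 1 / (w * t) ^ K"
      using wt pos[of 0] frac_le[of 1 1 "2 * (w * t) ^ K" "X 0 ^ K"] by (simp add: z_def)
    \<comment> \<open>By \<open>z_le\<close>, indices up to \<open>q\<close> keep
      \<open>z n \<le> 1 / (w * t) ^ K\<close>, that is \<open>X n \<ge> w * t\<close>.\<close>
    define q where "q = (1 / (w * t) ^ K - z 0) / B"
    have "z 0 > 0" using pos[of 0] by (simp add: z_def)
    then have "q \<ge> 0" using z0 B by (simp add: q_def)
    define N where "N = nat \<lfloor>q\<rfloor>"
    have N: "real N \<le> q" "q \<le> real (Suc N)"
      using \<open>q \<ge> 0\<close> unfolding N_def by linarith+
    have Xn: "w * t \<le> X n" if "n \<le> N" for n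
    proof -
      have "real n * B \<le> q * B" using that N B by (intro mult_right_mono) auto
      then have "z n \<le> 1 / (w * t) ^ K" using z_le[of n] B by (simp add: q_def)
      then have "(w * t) ^ K \<le> X n ^ K"
        using wt pos[of n] by (simp add: z_def field_simps del: power_mult_distrib)
      then show ?thesis using wt pos[of n] K by simp
    qed
    \<comment> \<open>The single gap after \<open>X m\<close> is already long enough, and
      \<open>X n\<close> is at most \<open>X (Suc m)\<close> by monotonicity.\<close>
    have sep: "2 * e \<le> dist (\<gamma> (X m)) (\<gamma> (X n))" if "m < n" "n \<le> N" for m n
    proof -
      have "2 \<le> a * w" using \<open>0 < a\<close> by (simp add: w_def field_simps max_def)
      also have "\<dots> \<le> a * w ^ k"
        using power_increasing[of 1 k w] \<open>w \<ge> 1\<close> \<open>0 < a\<close> k by simp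
      finally have "2 * e \<le> a * w ^ k * e" using e by (intro mult_right_mono) auto
      also have "\<dots> = a * (w * t) ^ k" by (simp add: e_def power_mult_distrib)
      also have "\<dots> \<le> a * X m ^ k"
        using Xn[of m] that wt \<open>0 < a\<close> by (intro mult_left_mono power_mono) auto
      also have "\<dots> \<le> X m - X (Suc m)" using up[of m] by simp
      also have "\<dots> \<le> \<bar>X m - X n\<bar>" using anti[of "Suc m" n] that by simp
      also have "\<dots> \<le> dist (\<gamma> (X m)) (\<gamma> (X n))" using range by (intro expand) auto
      finally show ?thesis .
    qed
    have sep': "2 * e \<le> dist (\<gamma> (X m)) (\<gamma> (X n))" if "m \<noteq> n" "m \<le> N" "n \<le> N" for m n
      using that sep[of m n] sep[of n m] by (cases m n rule: linorder_cases) (auto simp: dist_commute)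
    define P where "P = (\<lambda>n. \<gamma> (X n)) ` {..N}"
    have "inj_on (\<lambda>n. \<gamma> (X n)) {..N}"
      using sep' e by (fastforce intro: inj_onI)
    then have "card P = Suc N" by (simp add: P_def card_image)
    have "1 / (2 * B * (w * t) ^ K) \<le> q"
      using z0 B wt by (simp add: q_def field_simps)
    \<comment> \<open>The \<open>N + 1\<close> indices include 0, so their number is at least
      \<open>q\<close> although \<open>N\<close> is rounded down.\<close>
    also have "\<dots> \<le> real (card P)" using N \<open>card P = Suc N\<close> by simp
    finally have cardP: "1 / (2 * B * (w * t) ^ K) \<le> real (card P)" .
    have "c * (e ^ DIM('a) / t ^ K) = 1 / (2 * B * (w * t) ^ K) * (V * e ^ DIM('a))"
      by (simp add: c_def power_mult_distrib)
    also have "\<dots> \<le> real (card P) * (V * e ^ DIM('a))"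
      using cardP V e by (intro mult_right_mono) auto
    also have "\<dots> \<le> measure lebesgue (parallel_set A e)"
      unfolding V_def
    proof (rule measure_parallel_set_ge_packing[OF \<open>bounded A\<close>])
      show "2 * e \<le> dist p q" if "p \<in> P" "q \<in> P" "p \<noteq> q" for p q
      proof -
        from that obtain m n where "m \<le> N" "n \<le> N" "p = \<gamma> (X m)" "q = \<gamma> (X n)"
          by (auto simp: P_def)
        then show ?thesis using sep'[of m n] that(3) by auto
      qed
    qed (use e in \<open>auto simp: P_def A_def\<close>)
    finally show ?thesis by (simp add: e_def)
  qed

  have d: "1 - 1 / real k = real K / real k"
    by (simp add: k field_simps)
  have ev: "eventually (\<lambda>e. 0 < e \<and> e powr (1 / real k) < min 1 (X 0 / (2 * w))) (at_right 0)"
  proof -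
    have "((\<lambda>e. e powr (1 / real k)) \<longlongrightarrow> 0) (at_right 0)"
      by (rule tendsto_powr_at_right_0) (simp add: k)
    moreover have "0 < min 1 (X 0 / (2 * w))" using pos[of 0] \<open>w \<ge> 1\<close> by simp
    ultimately show ?thesis
      using eventually_at_right_less[of "0::real"] by (intro eventually_conj order_tendstoD(2)) auto
  qed
  have "has_box_dim A (1 - 1 / real k)"
  proof (rule has_box_dim_if_power_bounds[OF \<open>bounded A\<close> _ \<open>c > 0\<close>])
    show "0 < 1 - 1 / real k" using \<open>2 \<le> k\<close> by simp
    show "eventually (\<lambda>e. c * e powr (real DIM('a) - (1 - 1 / real k)) \<le> measure lebesgue (parallel_set A e) \<and>
            measure lebesgue (parallel_set A e) \<le> C * e powr (real DIM('a) - (1 - 1 / real k))) (at_right 0)"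
      using ev
    proof eventually_elim
      case (elim e)
      \<comment> \<open>As \<open>1 - 1 / k = K / k\<close>, this turns the exponent of the goal
        into \<open>e ^ DIM('a) / t ^ K\<close>, the form of \<open>upper\<close> and
        \<open>lower\<close>.\<close>
      define t where "t = e powr (1 / real k)"
      have t: "t > 0" "t < 1" "t < X 0 / (2 * w)" using elim by (auto simp: t_def)
      have te: "t ^ k = e" unfolding t_def using elim \<open>2 \<le> k\<close> by (simp add: powr_power)
      have "t ^ K = e powr (real K / real k)" using elim by (simp add: t_def powr_power)
      then have "e powr (real DIM('a) - (1 - 1 / real k)) = e ^ DIM('a) / t ^ K"
        using elim by (simp add: d powr_diff powr_realpow)
      moreover have "w * t \<le> X 0 / 2" using t \<open>w \<ge> 1\<close> by (simp add: field_simps)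
      ultimately show ?case
        using upper[of t] lower[of t] t by (simp add: te)
    qed
  qed
  then show ?thesis by (simp add: A_def)
qed

subsection \<open>Nondegenerate maps and time-1 maps\<close>

text \<open>Derivatives at points of an open set depend only on the values there. The lemma serves
  to replace a directional Frechet derivative by \<open>deriv\<close>.\<close>

lemma Ck_on_cong:
  assumes "open U" "\<And>x. x \<in> U \<Longrightarrow> f x = g x" "Ck_on n f U"
  shows "Ck_on n g U"
  using assms(2,3)
proof (induction n arbitrary: f g)
  case 0
  then show ?case by (simp cong: continuous_on_cong)
next
  case (Suc n)
  have der: "(g has_derivative frechet_derivative f (at x)) (at x)" if "x \<in> U" for x
  proof (rule has_derivative_transform_within_open[OF _ \<open>open U\<close> that])
    show "(f has_derivative frechet_derivative f (at x)) (at x)"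
      using Suc.prems(2) that by (simp add: frechet_derivative_works)
  qed (use Suc.prems in auto)
  have "Ck_on n (\<lambda>x. frechet_derivative g (at x) v) U" for v
  proof (rule Suc.IH)
    show "Ck_on n (\<lambda>x. frechet_derivative f (at x) v) U" using Suc.prems by simp
    show "frechet_derivative f (at x) v = frechet_derivative g (at x) v" if "x \<in> U" for x
      using frechet_derivative_at[OF der[OF that]] by simp
  qed
  with der show ?case by (auto simp: differentiable_def)
qed

lemma Ck_on_imp_continuous_on: "Ck_on n f U \<Longrightarrow> continuous_on U f"
  by (cases n)
     (auto intro!: continuous_at_imp_continuous_on differentiable_imp_continuous_within)

text \<open>On the real line the Frechet derivative in direction 1 is \<open>deriv f\<close>, which
  turns the recursion of \<open>Ck_on\<close> into one on iterated \<open>deriv\<close>.\<close>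

lemma Ck_on_Suc_deriv:
  fixes f :: "real \<Rightarrow> real"
  assumes "open U" "Ck_on (Suc n) f U"
  shows "\<And>x. x \<in> U \<Longrightarrow> (f has_real_derivative deriv f x) (at x)" and "Ck_on n (deriv f) U"
proof -
  show der: "(f has_real_derivative deriv f x) (at x)" if "x \<in> U" for x
    using assms that by (simp add: DERIV_deriv_iff_real_differentiable)
  show "Ck_on n (deriv f) U"
  proof (rule Ck_on_cong[OF \<open>open U\<close>])
    show "Ck_on n (\<lambda>x. frechet_derivative f (at x) 1) U" using assms by simp
    show "frechet_derivative f (at x) 1 = deriv f x" if "x \<in> U" for x
      using frechet_derivative_at[OF der[OF that, unfolded has_field_derivative_def], symmetric] by simp
  qed
qed

lemma Ck_on_deriv_funpow:
  fixes f :: "real \<Rightarrow> real"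
  assumes "open U" "Ck_on (j + n) f U"
  shows "Ck_on n ((deriv ^^ j) f) U"
  using assms(2)
proof (induction j arbitrary: n)
  case (Suc j)
  have "Ck_on (Suc n) ((deriv ^^ j) f) U"
    using Suc.prems by (intro Suc.IH) (metis add_Suc_shift)
  then show ?case using Ck_on_Suc_deriv(2)[OF assms(1)] by (simp del: Ck_on.simps)
qed simp

text \<open>In Maclaurin's formula with Lagrange remainder, nondegeneracy leaves only the linear
  term and the remainder. Its coefficient stays close to the nonzero value at 0 by continuity of the
  \<open>k\<close>-th derivative: \<open>\<eta>\<close> is the sign of that value, and
  \<open>c\<close> the absolute value of the coefficient at an intermediate point.\<close>

lemma nondegenerate_at_0_expansion:
  assumes "nondegenerate_at_0 k \<phi>"
  obtains \<eta> a b \<tau> :: real where "\<eta> = 1 \<or> \<eta> = -1" "0 < a" "0 < \<tau>" "continuous_on {-\<tau>..\<tau>} \<phi>"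
    and "\<And>x. \<bar>x\<bar> \<le> \<tau> \<Longrightarrow> \<exists>c\<in>{a..b}. \<phi> x = x + \<eta> * c * x ^ k"
proof -
  from assms obtain W where k: "2 \<le> k" and W: "open W" "0 \<in> W" "Ck_on k \<phi> W"
    and \<phi>: "\<phi> 0 = 0" "deriv \<phi> 0 = 1" "\<And>j. 2 \<le> j \<Longrightarrow> j < k \<Longrightarrow> (deriv ^^ j) \<phi> 0 = 0"
    and nz: "(deriv ^^ k) \<phi> 0 \<noteq> 0"
    unfolding nondegenerate_at_0_def by auto
  define q where "q x = (deriv ^^ k) \<phi> x / fact k" for x
  have "continuous_on W ((deriv ^^ k) \<phi>)"
    using Ck_on_deriv_funpow[OF W(1), of k 0] W(3) by (simp add: Ck_on_imp_continuous_on)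
  then have "isCont q 0"
    unfolding q_def using W by (intro continuous_intros) (auto simp: continuous_on_eq_continuous_at)
  moreover have q0: "q 0 \<noteq> 0" using nz by (simp add: q_def)
  ultimately have "eventually (\<lambda>x. dist (q x) (q 0) < \<bar>q 0\<bar> / 2) (nhds 0)"
    unfolding isCont_def by (intro tendstoD) (auto simp: tendsto_at_iff_tendsto_nhds)
  moreover have "eventually (\<lambda>x. x \<in> W) (nhds 0)" using W by (simp add: eventually_nhds_in_open)
  ultimately have "eventually (\<lambda>x. dist (q x) (q 0) < \<bar>q 0\<bar> / 2 \<and> x \<in> W) (nhds 0)"
    by (rule eventually_conj)
  then obtain e where "e > 0" and e: "\<And>x. \<bar>x\<bar> < e \<Longrightarrow> \<bar>q x - q 0\<bar> < \<bar>q 0\<bar> / 2 \<and> x \<in> W"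
    by (auto simp: eventually_nhds_metric dist_real_def)
  show ?thesis
  proof
    show "sgn (q 0) = 1 \<or> sgn (q 0) = -1" using q0 by (simp add: sgn_if)
    show "0 < \<bar>q 0\<bar> / 2" "0 < e / 2" using q0 \<open>e > 0\<close> by auto
    show "continuous_on {-(e/2)..e/2} \<phi>"
    proof (rule continuous_on_subset[OF Ck_on_imp_continuous_on[OF W(3)]])
      show "{-(e/2)..e/2} \<subseteq> W" using e \<open>e > 0\<close> by force
    qed
    fix x :: real assume x: "\<bar>x\<bar> \<le> e / 2"
    have "\<exists>t. \<bar>t\<bar> \<le> \<bar>x\<bar> \<and> \<phi> x = (\<Sum>m<k. (deriv ^^ m) \<phi> 0 / fact m * x ^ m) + (deriv ^^ k) \<phi> t / fact k * x ^ k"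
    proof (rule Maclaurin_bi_le, simp, intro allI impI, elim conjE)
      fix m t assume m: "m < k" and t: "\<bar>t\<bar> \<le> \<bar>x\<bar>"
      have "Ck_on (Suc (k - Suc m)) ((deriv ^^ m) \<phi>) W"
        using Ck_on_deriv_funpow[OF W(1), of m "Suc (k - Suc m)"] W(3) m by simp
      moreover have "t \<in> W" using e[of t] t x \<open>e > 0\<close> by simp
      ultimately show "((deriv ^^ m) \<phi> has_real_derivative (deriv ^^ Suc m) \<phi> t) (at t)"
        using Ck_on_Suc_deriv(1)[OF W(1)] by simp
    qed
    then obtain t where t: "\<bar>t\<bar> \<le> \<bar>x\<bar>"
      and tay: "\<phi> x = (\<Sum>m<k. (deriv ^^ m) \<phi> 0 / fact m * x ^ m) + q t * x ^ k"
      by (auto simp: q_def)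
    have "(\<Sum>m<k. (deriv ^^ m) \<phi> 0 / fact m * x ^ m) = (\<Sum>m\<in>{1}. (deriv ^^ m) \<phi> 0 / fact m * x ^ m)"
    proof (rule sum.mono_neutral_right)
      show "\<forall>m\<in>{..<k} - {1}. (deriv ^^ m) \<phi> 0 / fact m * x ^ m = 0"
      proof
        fix m assume "m \<in> {..<k} - {1}"
        then have "m = 0 \<or> (2 \<le> m \<and> m < k)" by auto
        then show "(deriv ^^ m) \<phi> 0 / fact m * x ^ m = 0" using \<phi> by auto
      qed
    qed (use k in auto)
    with tay \<phi>(2) have exp: "\<phi> x = x + q t * x ^ k" by simp
    have close: "\<bar>q t - q 0\<bar> < \<bar>q 0\<bar> / 2" using e[of t] t x \<open>e > 0\<close> by simp
    then have qt: "q t = sgn (q 0) * \<bar>q t\<bar>" by (auto simp: sgn_if abs_if split: if_splits)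
    show "\<exists>c\<in>{\<bar>q 0\<bar> / 2..2 * \<bar>q 0\<bar>}. \<phi> x = x + sgn (q 0) * c * x ^ k"
    proof (rule bexI)
      show "\<phi> x = x + sgn (q 0) * \<bar>q t\<bar> * x ^ k"
        by (subst qt[symmetric]) (rule exp)
      show "\<bar>q t\<bar> \<in> {\<bar>q 0\<bar> / 2..2 * \<bar>q 0\<bar>}"
        using close unfolding atLeastAtMost_iff by linarith
    qed
  qed
qed

lemma C1_lipschitz_on_Icc:
  fixes F F' :: "real \<Rightarrow> real"
  assumes "\<And>x. x \<in> I \<Longrightarrow> (F has_real_derivative F' x) (at x)" "continuous_on I F'" "{p..q} \<subseteq> I"
  obtains M where "\<And>x y. x \<in> {p..q} \<Longrightarrow> y \<in> {p..q} \<Longrightarrow> \<bar>F x - F y\<bar> \<le> M * \<bar>x - y\<bar>"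
proof -
  have "bounded (F' ` {p..q})"
    using continuous_on_subset[OF assms(2,3)]
    by (intro compact_imp_bounded compact_continuous_image) auto
  then obtain M where "\<forall>z\<in>F' ` {p..q}. norm z \<le> M"
    unfolding bounded_iff by blast
  then have M: "norm (F' x) \<le> M" if "x \<in> {p..q}" for x
    using \<open>\<forall>z\<in>F' ` {p..q}. norm z \<le> M\<close> that by simp
  have "norm (F x - F y) \<le> M * norm (x - y)" if "x \<in> {p..q}" "y \<in> {p..q}" for x y
  proof (rule field_differentiable_bound[of "{p..q}" F F', OF _ _ M that])
    show "(F has_real_derivative F' z) (at z within {p..q})" if "z \<in> {p..q}" for z
      using assms(1)[OF subsetD[OF assms(3) that]] by (rule has_field_derivative_at_within)
  qed simp
  then show ?thesis by (intro that) simp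
qed

text \<open>Gronwall: \<open>(u - v)\<^sup>2 exp (2 M t)\<close> is nondecreasing and vanishes at \<open>t = 1\<close>.\<close>

lemma backward_uniqueness:
  fixes F u v :: "real \<Rightarrow> real"
  assumes lip: "\<And>x y. x \<in> S \<Longrightarrow> y \<in> S \<Longrightarrow> \<bar>F x - F y\<bar> \<le> M * \<bar>x - y\<bar>"
    and u: "\<And>t. t \<in> {0..1} \<Longrightarrow> u t \<in> S \<and> (u has_real_derivative F (u t)) (at t within {0..1})"
    and v: "\<And>t. t \<in> {0..1} \<Longrightarrow> v t \<in> S \<and> (v has_real_derivative F (v t)) (at t within {0..1})"
    and "u 1 = v 1"
  shows "u 0 = v 0"
proof -
  define w where "w t = (u t - v t)\<^sup>2 * exp (2 * M * t)" for t
  define w' where "w' t = 2 * ((u t - v t) * (F (u t) - F (v t)) + M * (u t - v t)\<^sup>2) * exp (2 * M * t)" for t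
  have "(w has_real_derivative w' t) (at t within {0..1})" if "t \<in> {0..1}" for t
    unfolding w_def w'_def using u[OF that] v[OF that]
    by (auto intro!: derivative_eq_intros simp: power2_eq_square algebra_simps)
  \<comment> \<open>By the mean value theorem \<open>w 1 - w 0\<close> is a value of
    \<open>w'\<close>, hence nonnegative; as \<open>w 1 = 0\<close>, it is also minus the square of
    \<open>u 0 - v 0\<close>.\<close>
  then have "\<exists>t\<in>{0..1}. w 1 - w 0 = w' t * (1 - 0)"
    by (intro mvt_very_simple[where f' = "\<lambda>t. (*) (w' t)"]) (auto simp: has_field_derivative_def)
  then obtain t where t: "t \<in> {0..1}" "w 1 - w 0 = w' t" by auto
  have "\<bar>u t - v t\<bar> * \<bar>F (u t) - F (v t)\<bar> \<le> \<bar>u t - v t\<bar> * (M * \<bar>u t - v t\<bar>)"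
    using lip[of "u t" "v t"] u[OF t(1)] v[OF t(1)] by (intro mult_left_mono) auto
  moreover have "- (\<bar>u t - v t\<bar> * \<bar>F (u t) - F (v t)\<bar>) \<le> (u t - v t) * (F (u t) - F (v t))"
    using abs_ge_minus_self[of "(u t - v t) * (F (u t) - F (v t))"] by (simp only: abs_mult)
  moreover have "\<bar>u t - v t\<bar> * (M * \<bar>u t - v t\<bar>) = M * (u t - v t)\<^sup>2"
    by (simp only: mult.left_commute[of "\<bar>u t - v t\<bar>"] abs_mult_self_eq power2_eq_square)
  ultimately have "0 \<le> (u t - v t) * (F (u t) - F (v t)) + M * (u t - v t)\<^sup>2"
    by linarith
  then have "w' t \<ge> 0" unfolding w'_def by (intro mult_nonneg_nonneg) auto
  moreover have "w' t = - (u 0 - v 0)\<^sup>2"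
    using t(2) \<open>u 1 = v 1\<close> by (simp add: w_def)
  ultimately show ?thesis by simp
qed

text \<open>Trajectories with the same value at time 1 agree at time 0. Injectivity ensures that
  \<open>inv_into D\<close> returns the preimage near 0 in the unstable case.\<close>

lemma inj_on_unit_time_map:
  assumes F: "\<And>x. x \<in> {-\<delta><..<\<delta>} \<Longrightarrow> (F has_real_derivative F' x) (at x)"
    and F': "continuous_on {-\<delta><..<\<delta>} F'"
    and \<phi>: "unit_time_map_on F \<delta> D \<phi>"
  shows "inj_on \<phi> D"
proof (rule inj_onI)
  fix x y assume "x \<in> D" "y \<in> D" "\<phi> x = \<phi> y"
  with \<phi> obtain u v where u: "u 0 = x" "u 1 = \<phi> x"
      "\<And>t. t \<in> {0..1} \<Longrightarrow> \<bar>u t\<bar> < \<delta> \<and> (u has_real_derivative F (u t)) (at t within {0..1})"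
    and v: "v 0 = y" "v 1 = \<phi> y"
      "\<And>t. t \<in> {0..1} \<Longrightarrow> \<bar>v t\<bar> < \<delta> \<and> (v has_real_derivative F (v t)) (at t within {0..1})"
    unfolding unit_time_map_on_def by metis
  \<comment> \<open>A Lipschitz constant is at hand only on compact subintervals; a trajectory over
    \<open>{0..1}\<close> stays in one because its absolute value attains a maximum.\<close>
  have compact_range: "\<exists>K<\<delta>. \<forall>t\<in>{0..1}. \<bar>r t\<bar> \<le> K"
    if r: "\<And>t. t \<in> {0..1} \<Longrightarrow> \<bar>r t\<bar> < \<delta> \<and> (r has_real_derivative F (r t)) (at t within {0..1})" for r
  proof -
    have "continuous_on {0..1} (\<lambda>t. \<bar>r t\<bar>)"
      unfolding continuous_on_eq_continuous_within
      using r by (intro ballI continuous_rabs DERIV_continuous) blast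
    then obtain t0 where "t0 \<in> {0..1}" "\<And>t. t \<in> {0..1} \<Longrightarrow> \<bar>r t\<bar> \<le> \<bar>r t0\<bar>"
      using continuous_attains_sup[of "{0..1::real}" "\<lambda>t. \<bar>r t\<bar>"] by auto
    with r[of t0] show ?thesis by blast
  qed
  obtain K1 where K1: "K1 < \<delta>" "\<forall>t\<in>{0..1}. \<bar>u t\<bar> \<le> K1"
    using compact_range[OF u(3)] by blast
  obtain K2 where K2: "K2 < \<delta>" "\<forall>t\<in>{0..1}. \<bar>v t\<bar> \<le> K2"
    using compact_range[OF v(3)] by blast
  define K where "K = max K1 K2"
  have "{-K..K} \<subseteq> {-\<delta><..<\<delta>}" using K1(1) K2(1) by (auto simp: K_def)
  then obtain M where M: "\<And>x y. x \<in> {-K..K} \<Longrightarrow> y \<in> {-K..K} \<Longrightarrow> \<bar>F x - F y\<bar> \<le> M * \<bar>x - y\<bar>"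
    using C1_lipschitz_on_Icc[OF F F'] by blast
  have "u 0 = v 0"
  proof (rule backward_uniqueness[OF M])
    show "u t \<in> {-K..K} \<and> (u has_real_derivative F (u t)) (at t within {0..1})"
      "v t \<in> {-K..K} \<and> (v has_real_derivative F (v t)) (at t within {0..1})" if "t \<in> {0..1}" for t
    proof -
      have "\<bar>u t\<bar> \<le> K" "\<bar>v t\<bar> \<le> K"
        using K1(2) K2(2) that by (auto simp: K_def le_max_iff_disj)
      then show "u t \<in> {-K..K} \<and> (u has_real_derivative F (u t)) (at t within {0..1})"
        "v t \<in> {-K..K} \<and> (v has_real_derivative F (v t)) (at t within {0..1})"
        using u(3)[OF that] v(3)[OF that] by (simp_all add: abs_le_iff)
    qed
    show "u 1 = v 1" using u(2) v(2) \<open>\<phi> x = \<phi> y\<close> by simp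
  qed
  then show "x = y" using u v by simp
qed

text \<open>By the chain rule the derivative is the \<open>x\<close>-partial of \<open>f\<close>
  plus \<open>deriv h\<close> times the \<open>y\<close>-partial, all continuous along the graph.
  This yields the local Lipschitz property behind uniqueness.\<close>

lemma C1_restriction_to_graph:
  fixes f :: "real \<times> real \<Rightarrow> real" and h :: "real \<Rightarrow> real"
  assumes "Ck_on (Suc m) f U" "open I" "Ck_on (Suc n) h I" "(\<lambda>x. (x, h x)) ` I \<subseteq> U"
  obtains F' where "\<And>x. x \<in> I \<Longrightarrow> ((\<lambda>x. f (x, h x)) has_real_derivative F' x) (at x)" "continuous_on I F'"
proof
  define F' where "F' x = frechet_derivative f (at (x, h x)) (1, 0)
    + deriv h x * frechet_derivative f (at (x, h x)) (0, 1)" for x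
  have graph: "(x, h x) \<in> U" if "x \<in> I" for x using assms(4) that by auto
  note h = Ck_on_Suc_deriv[OF assms(2,3)]
  show "((\<lambda>x. f (x, h x)) has_real_derivative F' x) (at x)" if "x \<in> I" for x
  proof -
    have f: "(f has_derivative frechet_derivative f (at (x, h x))) (at (x, h x))"
      using assms(1) graph[OF that] by (simp add: frechet_derivative_works)
    have "((\<lambda>x. (x, h x)) has_derivative (\<lambda>y. (y, deriv h x * y))) (at x)"
      using h(1)[OF that] by (auto intro!: has_derivative_Pair simp: has_field_derivative_def)
    from has_derivative_compose[OF this f]
    have "((\<lambda>x. f (x, h x)) has_derivative (\<lambda>y. frechet_derivative f (at (x, h x)) (y, deriv h x * y))) (at x)" .
    moreover have "frechet_derivative f (at (x, h x)) (y, deriv h x * y) = F' x * y" for y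
    proof -
      interpret linear "frechet_derivative f (at (x, h x))"
        using f by (rule has_derivative_linear)
      have "(y, deriv h x * y) = y *\<^sub>R ((1, 0) + deriv h x *\<^sub>R (0, 1))" by simp
      then show ?thesis by (simp only: add scaleR F'_def) (simp add: algebra_simps)
    qed
    ultimately show ?thesis by (simp add: has_field_derivative_def)
  qed
  have graph_cont: "continuous_on I (\<lambda>x. (x, h x))"
    using Ck_on_imp_continuous_on[OF assms(3)] by (intro continuous_intros)
  have "continuous_on U (\<lambda>p. frechet_derivative f (at p) v)" for v
  proof (rule Ck_on_imp_continuous_on)
    show "Ck_on m (\<lambda>p. frechet_derivative f (at p) v) U"
      using assms(1) by (cases v) simp
  qed
  then have "continuous_on I (\<lambda>x. frechet_derivative f (at (x, h x)) v)" for v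
    using graph_cont assms(4) by (rule continuous_on_compose2)
  then show "continuous_on I F'"
    unfolding F'_def using Ck_on_imp_continuous_on[OF h(2)] by (intro continuous_intros)
qed

subsection \<open>One-sided dynamics\<close>

lemma contracting_iterates:
  fixes \<Phi> :: "real \<Rightarrow> real"
  assumes "\<And>t. 0 < t \<Longrightarrow> t \<le> \<tau> \<Longrightarrow> 0 < \<Phi> t \<and> \<Phi> t \<le> t" "0 < t" "t \<le> \<tau>"
  shows "0 < (\<Phi> ^^ n) t \<and> (\<Phi> ^^ n) t \<le> t"
proof (induction n)
  case (Suc n)
  with assms(3) show ?case using assms(1)[of "(\<Phi> ^^ n) t"] by auto
qed (use assms in auto)

text \<open>Iterates that stay below \<tau> never fall below the start \<open>t\<close>, so every
  step adds at least \<open>a * t ^ k\<close>, which cannot go on forever.\<close>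

lemma expanding_iterates_escape:
  fixes \<Phi> :: "real \<Rightarrow> real"
  assumes \<Phi>: "\<And>t. 0 < t \<Longrightarrow> t \<le> \<tau> \<Longrightarrow> t + a * t ^ k \<le> \<Phi> t" and "0 < a" "0 < t"
  shows "\<exists>n. \<tau> \<le> \<bar>(\<Phi> ^^ n) t\<bar>"
proof (rule ccontr)
  assume "\<nexists>n. \<tau> \<le> \<bar>(\<Phi> ^^ n) t\<bar>"
  then have bounded: "\<bar>(\<Phi> ^^ n) t\<bar> < \<tau>" for n by (simp add: not_le)
  have "t + real n * (a * t ^ k) \<le> (\<Phi> ^^ n) t" for n
  proof (induction n)
    case (Suc n)
    have "0 \<le> real n * (a * t ^ k)" using assms by simp
    then have le: "t \<le> (\<Phi> ^^ n) t" using Suc by linarith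
    then have "a * t ^ k \<le> a * (\<Phi> ^^ n) t ^ k"
      using assms by (intro mult_left_mono power_mono) auto
    moreover have "(\<Phi> ^^ n) t + a * (\<Phi> ^^ n) t ^ k \<le> \<Phi> ((\<Phi> ^^ n) t)"
      using le bounded[of n] \<open>0 < t\<close> by (intro \<Phi>) auto
    ultimately show ?case using Suc by (simp add: algebra_simps)
  qed simp
  moreover obtain n where "\<tau> < real n * (a * t ^ k)"
    using ex_less_of_nat_mult[of "a * t ^ k"] assms by auto
  ultimately show False using bounded[of n] \<open>0 < t\<close> by (smt (verit))
qed

text \<open>Multiplication by \<open>sgn a\<close> is an involution that preserves absolute values;
  conjugation by it moves the side of \<open>a\<close> to the positive half-line.\<close>

lemma stable_from_side_of_reflect:
  fixes \<phi> :: "real \<Rightarrow> real"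
  assumes "a \<noteq> 0"
  shows "stable_from_side_of a \<phi> \<longleftrightarrow>
    (\<forall>e>0. \<exists>d>0. \<forall>t. 0 < t \<and> t < d \<longrightarrow> (\<forall>n. \<bar>((\<lambda>t. sgn a * \<phi> (sgn a * t)) ^^ n) t\<bar> < e))"
proof -
  define s where "s = sgn a"
  define \<Phi> where "\<Phi> t = s * \<phi> (s * t)" for t
  have s: "s * (s * x) = x" "\<bar>s * x\<bar> = \<bar>x\<bar>" for x
    using assms by (auto simp: s_def sgn_if)
  have conj: "(\<Phi> ^^ n) t = s * (\<phi> ^^ n) (s * t)" for n t
    by (induction n) (auto simp: \<Phi>_def s)
  have abs: "\<bar>(\<Phi> ^^ n) t\<bar> = \<bar>(\<phi> ^^ n) (s * t)\<bar>" for n t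
    by (simp only: conj s)
  have "(\<forall>x. sgn x = s \<and> \<bar>x\<bar> < d \<longrightarrow> (\<forall>n. \<bar>(\<phi> ^^ n) x\<bar> < e))
      \<longleftrightarrow> (\<forall>t. 0 < t \<and> t < d \<longrightarrow> (\<forall>n. \<bar>(\<Phi> ^^ n) t\<bar> < e))" (is "?L \<longleftrightarrow> ?R") for d e
  proof
    assume L: ?L
    show ?R
    proof (intro allI impI)
      fix t n assume "0 < t \<and> t < d"
      then have "sgn (s * t) = s" "\<bar>s * t\<bar> < d" 
        using assms s(2)[of t] by (auto simp: sgn_mult s_def)
      with L show "\<bar>(\<Phi> ^^ n) t\<bar> < e" unfolding abs by blast
    qed
  next
    assume R: ?R
    show ?L
    proof (intro allI impI)
      fix x n assume x: "sgn x = s \<and> \<bar>x\<bar> < d"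
      then have "x \<noteq> 0" using assms by (auto simp: s_def sgn_if split: if_splits)
      moreover have "s * \<bar>x\<bar> = x" using x by (metis mult.commute sgn_mult_abs)
      ultimately show "\<bar>(\<phi> ^^ n) x\<bar> < e"
        using R[rule_format, of "\<bar>x\<bar>" n] x abs[of n "\<bar>x\<bar>"] by simp
    qed
  qed
  then show ?thesis
    unfolding stable_from_side_of_def s_def[symmetric] \<Phi>_def[symmetric, abs_def] by simp
qed

text \<open>After reflection to the positive side the map either contracts or expands, which decides
  stability on that side; the orbit follows the map or its inverse branch and decreases in both
  cases. The loss from \<open>a\<close> to \<open>a / 2 ^ k\<close> comes from the inverse branch,
  where the gap is measured at a preimage of size at least half of
  \<open>\<bar>x n\<bar>\<close>.\<close>

lemma nondegenerate_orbit_decay: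
  fixes \<phi> :: "real \<Rightarrow> real" and x :: "nat \<Rightarrow> real"
  assumes "2 \<le> k" and \<eta>: "\<eta> = 1 \<or> \<eta> = -1" and "0 < a" "0 < \<tau>" and cont: "continuous_on {-\<tau>..\<tau>} \<phi>"
    and \<phi>: "\<And>x. \<bar>x\<bar> \<le> \<tau> \<Longrightarrow> \<exists>c\<in>{a..b}. \<phi> x = x + \<eta> * c * x ^ k"
    and small: "2 * (b * \<tau> ^ (k - 1)) \<le> 1"
    and D: "{-\<tau>..\<tau>} \<subseteq> D" and inj: "inj_on \<phi> D"
    and x0: "x 0 \<noteq> 0" "\<bar>x 0\<bar> \<le> \<tau>"
    and x: "\<And>n. x (Suc n) = (if stable_from_side_of (x 0) \<phi> then \<phi> (x n) else inv_into D \<phi> (x n))"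
  shows "x n = sgn (x 0) * \<bar>x n\<bar>" "0 < \<bar>x n\<bar>" "\<bar>x n\<bar> \<le> \<bar>x 0\<bar>"
    and "\<bar>x (Suc n)\<bar> \<le> \<bar>x n\<bar> - a / 2 ^ k * \<bar>x n\<bar> ^ k" "\<bar>x n\<bar> - b * \<bar>x n\<bar> ^ k \<le> \<bar>x (Suc n)\<bar>"
proof -
  define s where "s = sgn (x 0)"
  have s: "s = 1 \<or> s = -1" using x0 by (auto simp: s_def sgn_if)
  define \<Phi> where "\<Phi> t = s * \<phi> (s * t)" for t
  \<comment> \<open>The sign of the leading nonlinear term after reflection: -1 for contraction, 1
    for expansion.\<close>
  define \<sigma> where "\<sigma> = s * \<eta> * s ^ k"
  have \<sigma>: "\<sigma> = 1 \<or> \<sigma> = -1"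
    using s \<eta> by (cases "even k") (auto simp: \<sigma>_def)
  have "a \<le> b" using \<phi>[of 0] \<open>0 < \<tau>\<close> by auto
  have \<Phi>: "\<exists>c\<in>{a..b}. \<Phi> t = t + \<sigma> * c * t ^ k" if "0 \<le> t" "t \<le> \<tau>" for t
  proof -
    have "\<bar>s * t\<bar> \<le> \<tau>" using s that by auto
    then obtain c where c: "c \<in> {a..b}" "\<phi> (s * t) = s * t + \<eta> * c * (s * t) ^ k"
      using \<phi> by blast
    have "\<Phi> t = (s * s) * t + \<sigma> * c * t ^ k"
      unfolding \<Phi>_def c(2) \<sigma>_def power_mult_distrib by (simp add: algebra_simps)
    also have "s * s = 1" using s by auto
    finally show ?thesis using c(1) by auto
  qed
  \<comment> \<open>The nonlinear term is at most half of \<open>t\<close>; this keeps the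
    contracting map positive and bounds preimages of the expanding map from below.\<close>
  have small_t: "2 * (c * t ^ k) \<le> t" "0 < c * t ^ k" if t: "0 < t" "t \<le> \<tau>" and c: "c \<in> {a..b}" for c t
  proof -
    have "c * t ^ (k - 1) \<le> b * \<tau> ^ (k - 1)"
      using t c \<open>0 < a\<close> by (intro mult_mono power_mono) auto
    then have "2 * (c * t ^ (k - 1)) * t \<le> 1 * t"
      using small t by (intro mult_right_mono) auto
    moreover have "t ^ k = t ^ (k - 1) * t"
      using \<open>2 \<le> k\<close> by (cases k) auto
    ultimately show "2 * (c * t ^ k) \<le> t" by simp
    show "0 < c * t ^ k" using t c \<open>0 < a\<close> by simp
  qed
  have a': "a / 2 ^ k \<le> a" "0 < a / 2 ^ k" using \<open>0 < a\<close> by (auto simp: field_simps)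

  have step: "\<exists>t'. x (Suc n) = s * t' \<and> 0 < t' \<and> t' \<le> t \<and> t' \<le> t - a / 2 ^ k * t ^ k \<and> t - b * t ^ k \<le> t'"
    if t: "0 < t" "t \<le> \<tau>" "x n = s * t" for t n
  proof (cases "\<sigma> = 1")
    case False
    then have \<sigma>: "\<sigma> = -1" using \<sigma> by simp
    have decr: "0 < \<Phi> t \<and> \<Phi> t \<le> t" if pos: "0 < t" "t \<le> \<tau>" for t
    proof -
      obtain c where "c \<in> {a..b}" "\<Phi> t = t - c * t ^ k" using \<Phi>[of t] pos unfolding \<sigma> by auto
      then show ?thesis using small_t[OF pos, of c] pos by simp
    qed
    have "stable_from_side_of (x 0) \<phi>"
      unfolding stable_from_side_of_reflect[OF x0(1)] s_def[symmetric] \<Phi>_def[symmetric, abs_def]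
    proof (intro allI impI)
      fix e :: real assume "0 < e"
      have "\<bar>(\<Phi> ^^ n) t\<bar> < e" if "0 < t" "t < min e \<tau>" for t n
        using contracting_iterates[of \<tau> \<Phi> t n, OF decr] that by auto
      then show "\<exists>d>0. \<forall>t. 0 < t \<and> t < d \<longrightarrow> (\<forall>n. \<bar>(\<Phi> ^^ n) t\<bar> < e)"
        using \<open>0 < e\<close> \<open>0 < \<tau>\<close> by (intro exI[of _ "min e \<tau>"]) auto
    qed
    then have "x (Suc n) = s * \<Phi> t"
      using s t by (auto simp: x \<Phi>_def)
    moreover obtain c where c: "c \<in> {a..b}" "\<Phi> t = t - c * t ^ k" using \<Phi>[of t] t unfolding \<sigma> by auto
    moreover have "a / 2 ^ k * t ^ k \<le> c * t ^ k" "c * t ^ k \<le> b * t ^ k"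
      using c(1) a' t by (intro mult_right_mono; simp)+
    ultimately show ?thesis
      using decr[of t] t by (intro exI[of _ "\<Phi> t"]) auto
  next
    case True
    have unstable: "\<not> stable_from_side_of (x 0) \<phi>"
      unfolding stable_from_side_of_reflect[OF x0(1)] s_def[symmetric] \<Phi>_def[symmetric, abs_def]
    proof
      \<comment> \<open>Stability already fails for \<open>e\<close> equal to \<tau>: iterates of
        \<open>d / 2\<close> grow until they reach \<tau>.\<close>
      assume "\<forall>e>0. \<exists>d>0. \<forall>t. 0 < t \<and> t < d \<longrightarrow> (\<forall>n. \<bar>(\<Phi> ^^ n) t\<bar> < e)"
      from this[rule_format, OF \<open>0 < \<tau>\<close>]
      obtain d where "d > 0" and d: "\<forall>t. 0 < t \<and> t < d \<longrightarrow> (\<forall>n. \<bar>(\<Phi> ^^ n) t\<bar> < \<tau>)"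
        by (elim exE conjE)
      have "\<exists>n. \<tau> \<le> \<bar>(\<Phi> ^^ n) (d / 2)\<bar>"
      proof (rule expanding_iterates_escape[of \<tau> a k])
        fix t assume t: "0 < t" "t \<le> \<tau>"
        then obtain c where c: "c \<in> {a..b}" "\<Phi> t = t + c * t ^ k" using \<Phi>[of t] True by auto
        then show "t + a * t ^ k \<le> \<Phi> t" using t by (simp add: mult_right_mono)
      qed (use \<open>0 < a\<close> \<open>d > 0\<close> in auto)
      then obtain n where "\<tau> \<le> \<bar>(\<Phi> ^^ n) (d / 2)\<bar>" ..
      moreover have "\<bar>(\<Phi> ^^ n) (d / 2)\<bar> < \<tau>" using \<open>d > 0\<close> by (intro d[rule_format]) simp
      ultimately show False by simp
    qed
    \<comment> \<open>Since \<open>\<Phi> 0 \<le> t\<close> and \<open>t \<le> \<Phi> t\<close>, the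
      intermediate value theorem provides a preimage \<open>t'\<close> of \<open>t\<close> in
      \<open>{0..t}\<close>.\<close>
    have "continuous_on {0..t} \<Phi>"
      unfolding \<Phi>_def using s t
      by (intro continuous_intros continuous_on_compose2[OF cont]) auto
    moreover have "\<Phi> 0 \<le> t" using \<Phi>[of 0] t \<open>2 \<le> k\<close> by (auto simp: power_0_left)
    moreover have "t \<le> \<Phi> t"
    proof -
      obtain c where "c \<in> {a..b}" "\<Phi> t = t + c * t ^ k" using \<Phi>[of t] t unfolding True by auto
      then show ?thesis using small_t[OF t(1,2), of c] by simp
    qed
    ultimately obtain t' where t': "0 \<le> t'" "t' \<le> t" "\<Phi> t' = t"
      using IVT'[of \<Phi> 0 t t] t by auto
    obtain c where c: "c \<in> {a..b}" "t = t' + c * t' ^ k"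
      using \<Phi>[of t'] t' t True by auto
    then have "t' \<noteq> 0" using t \<open>2 \<le> k\<close> by (auto simp: power_0_left)
    then have pos: "0 < t'" using t' by simp
    have half: "t / 2 \<le> t'" using small_t[of t' c] pos t' t c by auto
    have "\<phi> (s * t') = x n" using t'(3) t(3) s by (auto simp: \<Phi>_def)
    moreover have "s * t' \<in> D" using D s t' t by auto
    \<comment> \<open>Injectivity on all of \<open>D\<close> identifies the chosen inverse value
      with the preimage found locally.\<close>
    ultimately have "x (Suc n) = s * t'"
      using unstable inj by (simp add: x inv_into_f_eq)
    moreover have "a / 2 ^ k * t ^ k \<le> c * t' ^ k"
    proof -
      have "a * (t / 2) ^ k \<le> c * t' ^ k"
        using half t c \<open>0 < a\<close> by (intro mult_mono power_mono) auto
      then show ?thesis by (simp add: power_divide)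
    qed
    moreover have "c * t' ^ k \<le> b * t ^ k"
      using c t' \<open>0 < a\<close> by (intro mult_mono power_mono) auto
    ultimately show ?thesis
      using pos t' c(2) by (intro exI[of _ t']) auto
  qed

  have abs_s: "\<bar>s * t\<bar> = \<bar>t\<bar>" for t using s by auto
  have inv: "x n = s * \<bar>x n\<bar> \<and> 0 < \<bar>x n\<bar> \<and> \<bar>x n\<bar> \<le> \<bar>x 0\<bar>" for n
  proof (induction n)
    case 0
    then show ?case using x0 by (simp add: s_def sgn_mult_abs)
  next
    case (Suc n)
    obtain t' where t': "x (Suc n) = s * t'" "0 < t'" "t' \<le> \<bar>x n\<bar>"
      using step[of "\<bar>x n\<bar>" n] Suc x0(2) by auto
    then have "\<bar>x (Suc n)\<bar> = t'" using abs_s[of t'] by simp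
    with t' Suc show ?case by simp
  qed
  show "x n = sgn (x 0) * \<bar>x n\<bar>" "0 < \<bar>x n\<bar>" "\<bar>x n\<bar> \<le> \<bar>x 0\<bar>"
    using inv[of n] by (simp_all only: s_def)
  obtain t' where t': "x (Suc n) = s * t'" "0 < t'"
    "t' \<le> \<bar>x n\<bar> - a / 2 ^ k * \<bar>x n\<bar> ^ k" "\<bar>x n\<bar> - b * \<bar>x n\<bar> ^ k \<le> t'"
    using step[of "\<bar>x n\<bar>" n] inv[of n] x0(2) by auto
  then have "\<bar>x (Suc n)\<bar> = t'" using abs_s[of t'] by simp
  with t' show "\<bar>x (Suc n)\<bar> \<le> \<bar>x n\<bar> - a / 2 ^ k * \<bar>x n\<bar> ^ k" "\<bar>x n\<bar> - b * \<bar>x n\<bar> ^ k \<le> \<bar>x (Suc n)\<bar>"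
    by simp_all
qed

section \<open>Box dimension of the orbit on the center manifold\<close>

theorem theorem13:
  fixes f g :: "real \<times> real \<Rightarrow> real" and h \<phi>\<^sub>1 :: "real \<Rightarrow> real"
    and lam\<^sub>2 \<delta> :: real and U :: "(real \<times> real) set" and D :: "real set"
    and m r k :: nat
  assumes "open U" and "0 \<in> U"
    and "2 \<le> m" and "Ck_on m f U" and "Ck_on m g U"
    and "starts_quadratic_at f 0" and "starts_quadratic_at g 0"
    and "lam\<^sub>2 < 0"
    and "1 \<le> r" and "local_center_manifold r U (planar_field f g lam\<^sub>2) \<delta> h"
    and "unit_time_map_on (\<lambda>x. f (x, h x)) \<delta> D \<phi>\<^sub>1"
    and "nondegenerate_at_0 k \<phi>\<^sub>1"
  shows "\<exists>\<rho>>0. \<forall>x y :: nat \<Rightarrow> real.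
           x 1 \<noteq> 0 \<and> y 1 = h (x 1) \<and> norm (x 1, y 1) < \<rho> \<and>
           (\<forall>n\<ge>1. x (Suc n) = (if stable_from_side_of (x 1) \<phi>\<^sub>1 then \<phi>\<^sub>1 (x n)
                                else inv_into D \<phi>\<^sub>1 (x n)) \<and>
                   y (Suc n) = h (x (Suc n)))
           \<longrightarrow> has_box_dim {(x n, y n) | n. n \<ge> 1} (1 - 1 / real k)"
proof -
  obtain m' r' where m': "m = Suc m'" and r': "r = Suc r'"
    using assms(3,9) by (metis Suc_le_D numeral_2_eq_2 One_nat_def)
  have k: "2 \<le> k" using assms(12) by (simp add: nondegenerate_at_0_def)
  have \<delta>: "0 < \<delta>" and h: "Ck_on (Suc r') h {-\<delta><..<\<delta>}"
    and graph: "(\<lambda>x. (x, h x)) ` {-\<delta><..<\<delta>} \<subseteq> U"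
    using assms(10) unfolding local_center_manifold_def r' by blast+
  obtain F' where "\<And>x. x \<in> {-\<delta><..<\<delta>} \<Longrightarrow> ((\<lambda>x. f (x, h x)) has_real_derivative F' x) (at x)"
    "continuous_on {-\<delta><..<\<delta>} F'"
    using C1_restriction_to_graph[OF assms(4)[unfolded m'] open_greaterThanLessThan h graph] by blast
  then have inj: "inj_on \<phi>\<^sub>1 D"
    using assms(11) by (rule inj_on_unit_time_map)
  note h' = Ck_on_Suc_deriv[OF open_greaterThanLessThan h]
  have "{-(\<delta>/2)..\<delta>/2} \<subseteq> {-\<delta><..<\<delta>}" using \<delta> by auto
  then obtain L where L: "\<And>x y. x \<in> {-(\<delta>/2)..\<delta>/2} \<Longrightarrow> y \<in> {-(\<delta>/2)..\<delta>/2} \<Longrightarrow> \<bar>h x - h y\<bar> \<le> L * \<bar>x - y\<bar>"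
    using C1_lipschitz_on_Icc[OF h'(1) Ck_on_imp_continuous_on[OF h'(2)]] by blast
  obtain \<eta> a b \<tau>\<^sub>0 where \<eta>: "\<eta> = 1 \<or> \<eta> = -1" and "0 < a" "0 < \<tau>\<^sub>0"
    and cont: "continuous_on {-\<tau>\<^sub>0..\<tau>\<^sub>0} \<phi>\<^sub>1"
    and \<phi>: "\<And>x. \<bar>x\<bar> \<le> \<tau>\<^sub>0 \<Longrightarrow> \<exists>c\<in>{a..b}. \<phi>\<^sub>1 x = x + \<eta> * c * x ^ k"
    using nondegenerate_at_0_expansion[OF assms(12)] by metis
  have "a \<le> b" using \<phi>[of 0] \<open>0 < \<tau>\<^sub>0\<close> by auto
  obtain d where "0 < d" and d: "\<And>x. \<bar>x\<bar> < d \<Longrightarrow> x \<in> D"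
    using assms(11) unfolding unit_time_map_on_def open_dist by (auto simp: dist_real_def)
  define \<beta> where "\<beta> = 2 * real (k - 1) * b"
  have \<beta>: "\<beta> > 0" using k \<open>0 < a\<close> \<open>a \<le> b\<close> by (simp add: \<beta>_def)
  \<comment> \<open>The bounds serve, in order, the expansion of \<open>\<phi>\<^sub>1\<close>, the
    inclusion of \<open>{-\<tau>..\<tau>}\<close> in \<open>D\<close>, the Lipschitz bound for
    \<open>h\<close>, and, with the last two, the smallness condition:
    \<open>t ^ (k - 1) \<le> t \<le> 1 / \<beta>\<close>.\<close>
  define \<tau> where "\<tau> = Min {\<tau>\<^sub>0, d / 2, \<delta> / 2, 1, 1 / \<beta>}"
  have \<tau>: "0 < \<tau>" "\<tau> \<le> \<tau>\<^sub>0" "\<tau> < d" "\<tau> \<le> \<delta> / 2" "\<tau> \<le> 1" "\<tau> \<le> 1 / \<beta>"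
    using \<open>0 < \<tau>\<^sub>0\<close> \<open>0 < d\<close> \<delta> \<beta> Min_le[of "{\<tau>\<^sub>0, d / 2, \<delta> / 2, 1, 1 / \<beta>}"]
    unfolding \<tau>_def by (auto intro: le_less_trans[of _ "d / 2"])
  have small: "2 * real (k - 1) * (b * t ^ (k - 1)) \<le> 1" if "0 \<le> t" "t \<le> \<tau>" for t
  proof -
    have "t ^ (k - 1) \<le> t ^ 1" using that \<tau> k by (intro power_decreasing) auto
    then have "\<beta> * t ^ (k - 1) \<le> \<beta> * (1 / \<beta>)"
      using that \<tau> \<beta> by (intro mult_left_mono) auto
    then have "\<beta> * t ^ (k - 1) \<le> 1" using \<beta> by simp
    then show ?thesis by (simp only: \<beta>_def mult.assoc)
  qed
  have small': "2 * (b * \<tau> ^ (k - 1)) \<le> 1"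
  proof -
    have "1 * (2 * (b * \<tau> ^ (k - 1))) \<le> real (k - 1) * (2 * (b * \<tau> ^ (k - 1)))"
      using k \<tau> \<open>0 < a\<close> \<open>a \<le> b\<close> by (intro mult_right_mono) auto
    then show ?thesis using small[of \<tau>] \<tau>(1) by (simp add: mult_ac)
  qed
  show ?thesis
  proof (intro exI[of _ \<tau>] conjI allI impI \<tau>(1), elim conjE)
    fix x y :: "nat \<Rightarrow> real"
    assume "x 1 \<noteq> 0" "y 1 = h (x 1)" and norm: "norm (x 1, y 1) < \<tau>"
      and rec: "\<forall>n\<ge>1. x (Suc n) = (if stable_from_side_of (x 1) \<phi>\<^sub>1 then \<phi>\<^sub>1 (x n)
                                else inv_into D \<phi>\<^sub>1 (x n)) \<and> y (Suc n) = h (x (Suc n))"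
    \<comment> \<open>The given sequence starts at index 1, \<open>X\<close> at index 0.\<close>
    define X where "X n = \<bar>x (Suc n)\<bar>" for n
    \<comment> \<open>As \<open>x 1 \<noteq> 0\<close>, the orbit has a definite side; started at 0
      it would be a single point, of dimension 0.\<close>
    define s where "s = sgn (x 1)"
    have s: "s = 1 \<or> s = -1" using \<open>x 1 \<noteq> 0\<close> by (auto simp: s_def sgn_if)
    have X0: "X 0 \<le> \<tau>" using norm norm_fst_le[of "x 1" "y 1"] by (simp add: X_def)
    have X: "x (Suc n) = s * X n" "0 < X n" "X n \<le> X 0"
      "X (Suc n) \<le> X n - a / 2 ^ k * X n ^ k" "X n - b * X n ^ k \<le> X (Suc n)" for n
    proof -
      have cont': "continuous_on {-\<tau>..\<tau>} \<phi>\<^sub>1" using \<tau> by (intro continuous_on_subset[OF cont]) auto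
      have \<phi>': "\<exists>c\<in>{a..b}. \<phi>\<^sub>1 x = x + \<eta> * c * x ^ k" if "\<bar>x\<bar> \<le> \<tau>" for x
        using that \<tau> by (intro \<phi>) auto
      have D: "{-\<tau>..\<tau>} \<subseteq> D" using \<tau> by (auto intro!: d)
      show "x (Suc n) = s * X n" "0 < X n" "X n \<le> X 0"
        "X (Suc n) \<le> X n - a / 2 ^ k * X n ^ k" "X n - b * X n ^ k \<le> X (Suc n)"
        using nondegenerate_orbit_decay[of k \<eta> a \<tau> \<phi>\<^sub>1 b D "\<lambda>n. x (Suc n)" n,
            OF k \<eta> \<open>0 < a\<close> \<tau>(1) cont' \<phi>' small' D inj] \<open>x 1 \<noteq> 0\<close> X0 rec
        by (auto simp: X_def s_def)
    qed
    \<comment> \<open>The arc of the graph on the side of the orbit: its first coordinate alone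
      gives the lower distance bound, and the Lipschitz bound for \<open>h\<close> the upper
      one.\<close>
    define \<gamma> where "\<gamma> t = (s * t, h (s * t))" for t
    have "has_box_dim (range (\<lambda>n. \<gamma> (X n))) (1 - 1 / real k)"
    proof (rule has_box_dim_orbit_on_curve[where a = "a / 2 ^ k" and b = b and L = "1 + L"])
      show "0 < a / 2 ^ k" using \<open>0 < a\<close> by simp
      show "2 * real (k - 1) * (b * X 0 ^ (k - 1)) \<le> 1"
        using X(2)[of 0] X0 by (intro small) auto
      fix t t' assume "t \<in> {0..X 0}" "t' \<in> {0..X 0}"
      then have "s * t \<in> {-(\<delta>/2)..\<delta>/2}" "s * t' \<in> {-(\<delta>/2)..\<delta>/2}"
        using s X0 \<tau> by auto
      note L = L[OF this]
      have abs: "\<bar>s * t - s * t'\<bar> = \<bar>t - t'\<bar>" using s by auto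
      show "\<bar>t - t'\<bar> \<le> dist (\<gamma> t) (\<gamma> t')"
        using dist_fst_le[of "\<gamma> t" "\<gamma> t'"] abs by (simp add: \<gamma>_def dist_real_def)
      have "dist (\<gamma> t) (\<gamma> t') \<le> \<bar>s * t - s * t'\<bar> + \<bar>h (s * t) - h (s * t')\<bar>"
        using sqrt_sum_squares_le_sum_abs by (simp add: \<gamma>_def dist_Pair_Pair dist_real_def)
      also have "\<dots> \<le> (1 + L) * \<bar>t - t'\<bar>"
        using L abs by (simp add: algebra_simps)
      finally show "dist (\<gamma> t) (\<gamma> t') \<le> (1 + L) * \<bar>t - t'\<bar>" .
    qed (rule k X(2) X(4) X(5))+
    also have "range (\<lambda>n. \<gamma> (X n)) = {(x n, y n) | n. n \<ge> 1}"
    proof -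
      have "y (Suc n) = h (x (Suc n))" for n
        using \<open>y 1 = h (x 1)\<close> rec by (cases n) auto
      then have "\<gamma> (X n) = (x (Suc n), y (Suc n))" for n
        by (simp add: \<gamma>_def X(1)[symmetric])
      then show ?thesis by (auto simp: image_def) (metis Suc_le_D One_nat_def)
    qed
    finally show "has_box_dim {(x n, y n) | n. n \<ge> 1} (1 - 1 / real k)" .
  qed
qed

end
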